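(* Let $(\Omega,\mathcal{F},\mu)$ be a probability space, let $\rho_1,\rho_2:L^\infty(\mu)\to\mathbb{R}$ be convex expectations, let $K_1,K_2\in L^\infty(\mu)$ with $0\le K_1<K_2$, and let $\alpha\in\mathbb{R}$ with $\rho_1(K_1)\le\alpha\le\rho_1(K_2)$. Put $\mathcal{X}_\alpha=\{X\in L^\infty(\mu): K_1\le X\le K_2,\ \rho_1(X)\le\alpha\}$. If $\rho_1$ and $\rho_2$ are continuous from below, then an optimal test exists, i.e. there is $X^*\in\mathcal{X}_\alpha$ with $$\rho_2(K_2-X^* )=\inf_{X\in\mathcal{X}_\alpha}\rho_2(K_2-X).$$
   Context: (In)equalities between random variables are understood $\mu$-a.e. A mapping $\rho:L^\infty(\mu)\to\mathbb{R}$ is a convex expectation if for all $X,Y\in L^\infty(\mu)$: (i) $X\ge Y$ implies $\rho(X)\ge\rho(Y)$; (ii) $\rho(X+c)=\rho(X)+c$ for every constant $c$; (iii) $\rho(\lambda X+(1-\lambda)Y)\le\lambda\rho(X)+(1-\lambda)\rho(Y)$ for $\lambda\in[0,1]$. It is continuous from below if $\rho(X_n)\to\rho(X)$ whenever $(X_n)_{n\ge1}\subset L^\infty(\mu)$ increases to some $X\in L^\infty(\mu)$. *)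

theory Defs
  imports "HOL-Probability.Probability"
begin

(* Elements of L-infinity are represented by measurable, essentially bounded functions, and all
   relations between them are taken almost everywhere. *)
definition Linfty :: "'a measure \<Rightarrow> ('a \<Rightarrow> real) set" where
  "Linfty M = {X \<in> borel_measurable M. \<exists>C::real. AE x in M. \<bar>X x\<bar> \<le> C}"

(* By almost-everywhere monotonicity, rho takes the same value on a.e.-equal functions, so it is a
   mapping on equivalence classes.  Its values outside Linfty M are irrelevant. *)
definition convex_expectation :: "'a measure \<Rightarrow> (('a \<Rightarrow> real) \<Rightarrow> real) \<Rightarrow> bool" where
  "convex_expectation M \<rho> \<longleftrightarrow>
     (\<forall>X\<in>Linfty M. \<forall>Y\<in>Linfty M. (AE x in M. X x \<ge> Y x) \<longrightarrow> \<rho> X \<ge> \<rho> Y) \<and>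
     (\<forall>X\<in>Linfty M. \<forall>c::real. \<rho> (\<lambda>x. X x + c) = \<rho> X + c) \<and>
     (\<forall>X\<in>Linfty M. \<forall>Y\<in>Linfty M. \<forall>t\<in>{0..1::real}.
        \<rho> (\<lambda>x. t * X x + (1 - t) * Y x) \<le> t * \<rho> X + (1 - t) * \<rho> Y)"

definition continuous_from_below :: "'a measure \<Rightarrow> (('a \<Rightarrow> real) \<Rightarrow> real) \<Rightarrow> bool" where
  "continuous_from_below M \<rho> \<longleftrightarrow>
     (\<forall>X Y. (\<forall>n::nat. X n \<in> Linfty M) \<longrightarrow> Y \<in> Linfty M \<longrightarrow>
        (\<forall>n. AE x in M. X n x \<le> X (Suc n) x) \<longrightarrow>
        (AE x in M. (\<lambda>n. X n x) \<longlonglongrightarrow> Y x) \<longrightarrow>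
        (\<lambda>n. \<rho> (X n)) \<longlonglongrightarrow> \<rho> Y)"

definition admissible_tests ::
  "'a measure \<Rightarrow> (('a \<Rightarrow> real) \<Rightarrow> real) \<Rightarrow> ('a \<Rightarrow> real) \<Rightarrow> ('a \<Rightarrow> real) \<Rightarrow> real \<Rightarrow> ('a \<Rightarrow> real) set" where
  "admissible_tests M \<rho> K1 K2 \<alpha> =
     {X \<in> Linfty M. (AE x in M. K1 x \<le> X x) \<and> (AE x in M. X x \<le> K2 x) \<and> \<rho> X \<le> \<alpha>}"

end

theory Submission imports Defs begin

text \<open>
  The sets of admissible tests whose value is within \<open>1 / n\<close> of the infimum form a decreasing
  sequence of convex sets of uniformly bounded functions. Choosing from them functions of almost
  minimal \<open>L\<^sup>2\<close> norm gives, by the parallelogram identity, a sequence that converges almost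
  everywhere; this replaces weak compactness or Komlos' lemma. Continuity from below yields
  lower semicontinuity of both expectations along bounded almost everywhere convergent sequences
  (apply it to the tail infima), so the limit is admissible and optimal.
\<close>

section \<open>Lower semicontinuity of convex expectations\<close>

lemma INF_tail_tendsto:
  fixes a :: "nat \<Rightarrow> real"
  assumes "a \<longlonglongrightarrow> L" and bdd: "bdd_below (range a)"
  shows "(\<lambda>n. INF k\<in>{n..}. a k) \<longlonglongrightarrow> L"
proof (rule order_tendstoI)
  have bdd': "bdd_below (a ` {n..})" for n
    using bdd by (rule bdd_below_mono) auto
  have le: "(INF k\<in>{n..}. a k) \<le> a n" for n
    by (rule cINF_lower[OF bdd']) simp
  show "eventually (\<lambda>n. (INF k\<in>{n..}. a k) < y) sequentially" if "L < y" for y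
    using order_tendstoD(2)[OF assms(1) that] by eventually_elim (rule le_less_trans[OF le])
  show "eventually (\<lambda>n. y < (INF k\<in>{n..}. a k)) sequentially" if "y < L" for y
  proof -
    \<comment> \<open>Values above \<open>z\<close> only force their infimum to be at least
      \<open>z\<close>, so \<open>z\<close> has to lie strictly above \<open>y\<close>.\<close>
    obtain z where z: "y < z" "z < L" using dense[of y L] \<open>y < L\<close> by auto
    obtain N where N: "\<And>k. k \<ge> N \<Longrightarrow> z < a k"
      using order_tendstoD(1)[OF assms(1) z(2)] by (auto simp: eventually_sequentially)
    have "z \<le> (INF k\<in>{n..}. a k)" if "n \<ge> N" for n
      by (rule cINF_greatest) (use N that in \<open>auto intro: less_imp_le\<close>)
    with z(1) show ?thesis by (auto simp: eventually_sequentially intro: less_le_trans)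
  qed
qed

lemma LinftyI:
  assumes "X \<in> borel_measurable M" "AE x in M. \<bar>X x\<bar> \<le> C"
  shows "X \<in> Linfty M"
  using assms by (auto simp: Linfty_def)

lemma Linfty_measurable: "X \<in> Linfty M \<Longrightarrow> X \<in> borel_measurable M"
  by (simp add: Linfty_def)

lemma Linfty_diff:
  assumes "X \<in> Linfty M" "Y \<in> Linfty M"
  shows "(\<lambda>x. X x - Y x) \<in> Linfty M"
proof -
  obtain C D where "AE x in M. \<bar>X x\<bar> \<le> C" "AE x in M. \<bar>Y x\<bar> \<le> D"
    using assms by (auto simp: Linfty_def)
  then have "AE x in M. \<bar>X x - Y x\<bar> \<le> C + D" by eventually_elim linarith
  then show ?thesis
    by (rule LinftyI[OF borel_measurable_diff[OF assms[THEN Linfty_measurable]]])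
qed

lemma convex_expectation_mono:
  assumes "convex_expectation M \<rho>" "X \<in> Linfty M" "Y \<in> Linfty M" "AE x in M. X x \<le> Y x"
  shows "\<rho> X \<le> \<rho> Y"
  using assms unfolding convex_expectation_def by blast

text \<open>Sublevel sets are closed under midpoints, which is the form of convexity that the
  parallelogram identity calls for.\<close>

lemma convex_expectation_midpoint:
  assumes "convex_expectation M \<rho>" "X \<in> Linfty M" "Y \<in> Linfty M"
    and "\<rho> X \<le> c" "\<rho> Y \<le> c"
  shows "\<rho> (\<lambda>x. (X x + Y x) / 2) \<le> c"
proof -
  have "\<forall>t\<in>{0..1}. \<rho> (\<lambda>x. t * X x + (1 - t) * Y x) \<le> t * \<rho> X + (1 - t) * \<rho> Y"
    using assms(1-3) unfolding convex_expectation_def by blast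
  from this[rule_format, of "1/2"]
  have "\<rho> (\<lambda>x. (X x + Y x) / 2) \<le> (\<rho> X + \<rho> Y) / 2"
    by (simp add: add_divide_distrib)
  then show ?thesis using assms(4,5) by simp
qed

text \<open>The tail infima lie below \<open>X n\<close> and increase to \<open>Y\<close>, so
  monotonicity bounds their values by \<open>c n\<close> while continuity from below sends these
  values to \<open>\<rho> Y\<close>. The bound may vary with \<open>n\<close> to cover minimising
  sequences, whose slack shrinks to zero.\<close>

lemma continuous_from_below_Fatou:
  assumes \<rho>: "convex_expectation M \<rho>" "continuous_from_below M \<rho>"
    and X: "\<And>n. X n \<in> borel_measurable M" "\<And>n. AE x in M. \<bar>X n x\<bar> \<le> C"
    and Y: "Y \<in> Linfty M"
    and lim: "AE x in M. (\<lambda>n. X n x) \<longlonglongrightarrow> Y x"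
    and c: "\<And>n. \<rho> (X n) \<le> c n" "c \<longlonglongrightarrow> c'"
  shows "\<rho> Y \<le> c'"
proof -
  \<comment> \<open>The truncation makes the tail infima well defined everywhere, not only almost everywhere.\<close>
  define T where "T n x = max (- C) (min C (X n x))" for n x
  define Z where "Z n x = (INF k\<in>{n..}. T k x)" for n x
  have bddT: "bdd_below ((\<lambda>k. T k x) ` S)" for x S
    by (rule bdd_belowI[of _ "- C"]) (auto simp: T_def)
  have T_meas: "T n \<in> borel_measurable M" for n
    unfolding T_def using X(1) by measurable
  have Z_meas: "Z n \<in> borel_measurable M" for n
    unfolding Z_def by (rule borel_measurable_cINF) (auto intro: T_meas bddT)
  have XT: "AE x in M. \<forall>n. \<bar>X n x\<bar> \<le> C"
    using X(2) by (simp add: AE_all_countable)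
  have Z_le: "Z n x \<le> T n x" for n x
    unfolding Z_def by (rule cINF_lower[OF bddT]) simp
  have Z_ge: "- C \<le> Z n x" for n x
    unfolding Z_def by (rule cINF_greatest) (auto simp: T_def)
  have Z_Linfty: "Z n \<in> Linfty M" for n
  proof (rule LinftyI[OF Z_meas, of _ C])
    \<comment> \<open>The sign of \<open>C\<close> is unknown, and truncated values stay below
      \<open>C\<close> only if \<open>C\<close> is nonnegative; the bound on \<open>X n x\<close>
      supplies this.\<close>
    show "AE x in M. \<bar>Z n x\<bar> \<le> C" using XT
    proof eventually_elim
      case (elim x)
      then have "\<bar>X n x\<bar> \<le> C" by blast
      then have "T n x \<le> C" by (simp add: T_def)
      then show ?case using Z_le[of n x] Z_ge[of n x] by linarith
    qed
  qed
  have "Z n x \<le> Z (Suc n) x" for n x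
    unfolding Z_def by (rule cINF_superset_mono) (auto intro: bddT)
  moreover have "AE x in M. (\<lambda>n. Z n x) \<longlonglongrightarrow> Y x" using lim XT
  proof eventually_elim
    case (elim x)
    have "T n x = X n x" for n
      using elim(2)[rule_format, of n] by (simp add: T_def)
    with elim(1) show ?case
      unfolding Z_def by (intro INF_tail_tendsto bddT) simp
  qed
  ultimately have conv: "(\<lambda>n. \<rho> (Z n)) \<longlonglongrightarrow> \<rho> Y"
    using \<rho>(2) Z_Linfty Y unfolding continuous_from_below_def by blast
  have "\<rho> (Z n) \<le> c n" for n
  proof -
    have "AE x in M. Z n x \<le> X n x" using XT
    proof eventually_elim
      case (elim x)
      then have "\<bar>X n x\<bar> \<le> C" by blast
      then have "T n x = X n x" by (simp add: T_def)
      then show ?case using Z_le[of n x] by simp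
    qed
    then have "\<rho> (Z n) \<le> \<rho> (X n)"
      by (rule convex_expectation_mono[OF \<rho>(1) Z_Linfty LinftyI[OF X]])
    then show ?thesis using c(1)[of n] by linarith
  qed
  then show ?thesis using conv c(2) by (intro LIMSEQ_le) auto
qed

section \<open>Almost everywhere convergence along nested convex sets\<close>

lemma AE_convergent_of_L1_increments:
  fixes f :: "nat \<Rightarrow> 'a \<Rightarrow> real"
  assumes int: "\<And>n. integrable M (f n)"
    and bound: "\<And>n. (\<integral>x. \<bar>f (Suc n) x - f n x\<bar> \<partial>M) \<le> b n" and "summable b"
  shows "AE x in M. convergent (\<lambda>n. f n x)"
proof -
  define d where "d n x = \<bar>f (Suc n) x - f n x\<bar>" for n x
  have d: "integrable M (d n)" for n
    unfolding d_def using int by auto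
  then have meas: "(\<lambda>x. ennreal (d n x)) \<in> borel_measurable M" for n
    by auto
  have b_nonneg: "0 \<le> b n" for n
    using bound[of n] by (rule order_trans[rotated]) auto
  \<comment> \<open>In \<open>ennreal\<close> sum and integral can be exchanged before any
    convergence is known; a finite integral then makes the series of increments finite almost
    everywhere.\<close>
  have "(\<integral>\<^sup>+x. (\<Sum>n. ennreal (d n x)) \<partial>M) = (\<Sum>n. \<integral>\<^sup>+x. ennreal (d n x) \<partial>M)"
    by (rule nn_integral_suminf[OF meas])
  also have "\<dots> = (\<Sum>n. ennreal (\<integral>x. d n x \<partial>M))"
    by (subst nn_integral_eq_integral[OF d]) (auto simp: d_def)
  also have "\<dots> \<le> (\<Sum>n. ennreal (b n))"
    by (rule suminf_le) (auto simp: d_def intro!: ennreal_leI bound)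
  also have "\<dots> = ennreal (\<Sum>n. b n)"
    by (rule suminf_ennreal2[OF b_nonneg assms(3)])
  finally have "(\<integral>\<^sup>+x. (\<Sum>n. ennreal (d n x)) \<partial>M) \<noteq> \<infinity>"
    by (auto simp: top_unique)
  then have "AE x in M. (\<Sum>n. ennreal (d n x)) \<noteq> \<infinity>"
    by (intro nn_integral_PInf_AE borel_measurable_suminf_order meas)
  then show ?thesis
  proof eventually_elim
    case (elim x)
    have "summable (\<lambda>n. d n x)"
      by (rule summable_suminf_not_top) (use elim in \<open>auto simp: d_def\<close>)
    then have "summable (\<lambda>n. f (Suc n) x - f n x)"
      unfolding d_def by (rule summable_rabs_cancel)
    then have "convergent (\<lambda>n. \<Sum>i<n. f (Suc i) x - f i x)"
      by (simp add: summable_iff_convergent)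
    then have "convergent (\<lambda>n. f n x - f 0 x)"
      by (subst (asm) sum_lessThan_telescope)
    then show ?case
      by (simp add: convergent_diff_const_right_iff)
  qed
qed

text \<open>Midpoints of near-minimisers of the squared norm stay in the set, so their norm cannot
  drop much below the minimum, and this forces the near-minimisers together. The sets need not be
  closed, so nothing is claimed about where the limit lies.\<close>

lemma (in prob_space) nested_convex_AE_convergent:
  fixes A :: "nat \<Rightarrow> ('a \<Rightarrow> real) set"
  assumes dec: "decseq A" and ne: "\<And>n. A n \<noteq> {}"
    and meas: "\<And>f. f \<in> A 0 \<Longrightarrow> f \<in> borel_measurable M"
    and bdd: "\<And>f. f \<in> A 0 \<Longrightarrow> AE x in M. \<bar>f x\<bar> \<le> C"
    and mid: "\<And>n f g. f \<in> A n \<Longrightarrow> g \<in> A n \<Longrightarrow> (\<lambda>x. (f x + g x) / 2) \<in> A n"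
  obtains f where "\<And>n. f n \<in> A n" "AE x in M. convergent (\<lambda>n. f n x)"
proof -
  define q where "q f = (\<integral>x. (f x)\<^sup>2 \<partial>M)" for f :: "'a \<Rightarrow> real"
  define J where "J n = (INF f\<in>A n. q f)" for n
  have A0: "f \<in> A 0" if "f \<in> A n" for f n
    using decseqD[OF dec, of 0 n] that by auto
  have sq_bdd: "AE x in M. (f x)\<^sup>2 \<le> C\<^sup>2" if "f \<in> A 0" for f
    using bdd[OF that]
  proof eventually_elim
    case (elim x)
    then show ?case using power_mono[OF elim, of 2] by simp
  qed
  have int: "integrable M f" "integrable M (\<lambda>x. (f x)\<^sup>2)" if "f \<in> A 0" for f
  proof -
    note [measurable] = meas[OF that]
    show "integrable M f" using bdd[OF that] by (intro integrable_const_bound[where B=C]) auto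
    show "integrable M (\<lambda>x. (f x)\<^sup>2)"
      using sq_bdd[OF that] by (intro integrable_const_bound[where B="C\<^sup>2"]) auto
  qed
  have q_le: "q f \<le> C\<^sup>2" if "f \<in> A 0" for f
  proof -
    have "q f \<le> (\<integral>x. C\<^sup>2 \<partial>M)"
      unfolding q_def by (rule integral_mono_AE[OF int(2)[OF that] _ sq_bdd[OF that]]) simp
    then show ?thesis by (simp add: prob_space)
  qed
  have bddq: "bdd_below (q ` S)" for S
    by (rule bdd_belowI[of _ 0]) (auto simp: q_def)
  have J_le: "J n \<le> q f" if "f \<in> A n" for n f
    unfolding J_def by (rule cINF_lower[OF bddq that])
  have J_bound: "J n \<le> C\<^sup>2" for n
    using ne[of n] J_le q_le A0 by (meson ex_in_conv order_trans)
  have "incseq J"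
    unfolding J_def
    by (intro incseq_SucI cINF_superset_mono ne bddq) (use dec in \<open>auto simp: decseq_Suc_iff\<close>)
  then obtain L where L: "J \<longlonglongrightarrow> L" "\<And>n. J n \<le> L"
    using incseq_convergent[of J "C\<^sup>2"] J_bound by auto
  \<comment> \<open>The rate 1/4 is chosen so that \<open>2 ^ k * e k\<close>, which arises on
    passing from squares to absolute values, is still summable.\<close>
  define e :: "nat \<Rightarrow> real" where "e k = (1/4) ^ k" for k
  have e_pos: "0 < e k" for k by (simp add: e_def)
  have "\<exists>n\<ge>k. L - e k < J n" for k
  proof -
    have "eventually (\<lambda>n. L - e k < J n) sequentially"
      by (rule order_tendstoD(1)[OF L(1)]) (simp add: e_pos)
    then have "eventually (\<lambda>n. k \<le> n \<and> L - e k < J n) sequentially"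
      using eventually_ge_at_top[of k] by eventually_elim simp
    then show ?thesis by (auto simp: eventually_sequentially)
  qed
  then obtain r0 where r0: "\<And>k. k \<le> r0 k" "\<And>k. L - e k < J (r0 k)" by metis
  \<comment> \<open>Passing to partial maxima makes the indices monotone.\<close>
  define r where "r k = Max (r0 ` {..k})" for k
  have r_ge: "r0 k \<le> r k" for k
    unfolding r_def by (rule Max_ge) auto
  have r_mono: "r k \<le> r (Suc k)" for k
    unfolding r_def by (rule Max_mono) auto
  have r: "L - e k < J (r k)" for k
    using r0(2)[of k] incseqD[OF \<open>incseq J\<close> r_ge[of k]] by linarith
  \<comment> \<open>With \<open>r\<close>, this puts the squared norm within \<open>e k\<close> of
    \<open>L\<close> from above, while every element of \<open>A (r k)\<close> stays above
    \<open>L - e k\<close>.\<close>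
  have "\<exists>f\<in>A (r k). q f < L + e k" for k
  proof -
    have "Inf (q ` A (r k)) < L + e k"
      using L(2)[of "r k"] e_pos[of k] unfolding J_def by linarith
    then show ?thesis
      using cInf_lessD[of "q ` A (r k)" "L + e k"] ne by auto
  qed
  then obtain f where f: "\<And>k. f k \<in> A (r k)" "\<And>k. q (f k) < L + e k" by metis
  have f0: "f k \<in> A 0" for k using A0 f(1) by blast
  have fA: "f k \<in> A k" for k
    using f(1)[of k] decseqD[OF dec order_trans[OF r0(1)[of k] r_ge[of k]]] by auto
  \<comment> \<open>The constant is 1/2 + 8/2: the constant term of the AM-GM bound plus half of the
    factor in the estimate \<open>8 * e k\<close> of the squared distance.\<close>
  have "(\<integral>x. \<bar>f (Suc k) x - f k x\<bar> \<partial>M) \<le> 9/2 * (1/2) ^ k" for k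
  proof -
    \<comment> \<open>As the sets decrease, both functions lie in the larger set
      \<open>A (r k)\<close>, hence so does their midpoint; \<open>sq\<close> is the parallelogram
      identity.\<close>
    define g where "g x = (f (Suc k) x + f k x) / 2" for x
    have "f (Suc k) \<in> A (r k)"
      using f(1)[of "Suc k"] decseqD[OF dec r_mono[of k]] by auto
    then have g: "g \<in> A (r k)" unfolding g_def using f(1) by (intro mid)
    note int' = int[OF f0[of k]] int[OF f0[of "Suc k"]] int[OF A0[OF g]]
    have sq: "(f (Suc k) x - f k x)\<^sup>2 = 2 * (f (Suc k) x)\<^sup>2 + 2 * (f k x)\<^sup>2 - 4 * (g x)\<^sup>2" for x
      by (simp add: g_def power2_eq_square field_simps)
    have int_sq: "integrable M (\<lambda>x. (f (Suc k) x - f k x)\<^sup>2)"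
      unfolding sq using int' by auto
    have "(\<integral>x. (f (Suc k) x - f k x)\<^sup>2 \<partial>M) = 2 * q (f (Suc k)) + 2 * q (f k) - 4 * q g"
      unfolding sq q_def using int' by simp
    \<comment> \<open>The terms in \<open>L\<close> cancel, leaving only
      \<open>8 * e k\<close>.\<close>
    also have "\<dots> \<le> 2 * (L + e k) + 2 * (L + e k) - 4 * (L - e k)"
    proof -
      have "e (Suc k) \<le> e k" by (simp add: e_def)
      then have "q (f (Suc k)) \<le> L + e k" "q (f k) \<le> L + e k" "L - e k \<le> q g"
        using f(2)[of k] f(2)[of "Suc k"] r[of k] J_le[OF g] by auto
      then show ?thesis by (intro diff_mono add_mono mult_left_mono) auto
    qed
    finally have sq_le: "(\<integral>x. (f (Suc k) x - f k x)\<^sup>2 \<partial>M) \<le> 8 * e k" by simp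
    \<comment> \<open>AM-GM instead of the Cauchy-Schwarz inequality.\<close>
    have am: "\<bar>d\<bar> \<le> (1/2) ^ k / 2 + 2 ^ k / 2 * d\<^sup>2" for d :: real
    proof -
      have "0 \<le> (2 ^ k * \<bar>d\<bar> - 1)\<^sup>2" by simp
      then have "2 * (2 ^ k * \<bar>d\<bar>) \<le> 1 + 2 ^ k * (2 ^ k * d\<^sup>2)"
        by (simp add: power2_diff power_mult_distrib) (simp add: power2_eq_square)
      then show ?thesis by (simp add: field_simps)
    qed
    have "(\<integral>x. \<bar>f (Suc k) x - f k x\<bar> \<partial>M)
        \<le> (\<integral>x. (1/2) ^ k / 2 + 2 ^ k / 2 * (f (Suc k) x - f k x)\<^sup>2 \<partial>M)"
      using int' int_sq am by (intro integral_mono) auto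
    also have "\<dots> = (1/2) ^ k / 2 + 2 ^ k / 2 * (\<integral>x. (f (Suc k) x - f k x)\<^sup>2 \<partial>M)"
      using int_sq by (simp add: prob_space)
    also have "\<dots> \<le> (1/2) ^ k / 2 + 2 ^ k / 2 * (8 * e k)"
      using sq_le by (intro add_left_mono mult_left_mono) auto
    also have "\<dots> = 9/2 * (1/2) ^ k"
    proof -
      have "(2::real) ^ k * e k = (1/2) ^ k"
        by (simp add: e_def flip: power_mult_distrib)
      then show ?thesis by (simp add: mult.commute)
    qed
    finally show ?thesis .
  qed
  then have "AE x in M. convergent (\<lambda>k. f k x)"
    by (rule AE_convergent_of_L1_increments[OF int(1)[OF f0]])
       (intro summable_mult summable_geometric, simp)
  with fA show ?thesis by (rule that)
qed

section \<open>Existence of an optimal test\<close>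

theorem theorem3p1:
  fixes M :: "'a measure"
    and \<rho>1 \<rho>2 :: "('a \<Rightarrow> real) \<Rightarrow> real"
    and K1 K2 :: "'a \<Rightarrow> real"
    and \<alpha> :: real
  assumes "prob_space M"
    and "convex_expectation M \<rho>1"
    and "convex_expectation M \<rho>2"
    and "K1 \<in> Linfty M"
    and "K2 \<in> Linfty M"
    and "AE x in M. 0 \<le> K1 x"
    and "AE x in M. K1 x < K2 x"
    and "\<rho>1 K1 \<le> \<alpha>"
    and "\<alpha> \<le> \<rho>1 K2"
    and "continuous_from_below M \<rho>1"
    and "continuous_from_below M \<rho>2"
  shows "\<exists>Xopt \<in> admissible_tests M \<rho>1 K1 K2 \<alpha>.
           \<rho>2 (\<lambda>x. K2 x - Xopt x)
             = (INF X \<in> admissible_tests M \<rho>1 K1 K2 \<alpha>. \<rho>2 (\<lambda>x. K2 x - X x))"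
proof -
  interpret prob_space M by fact
  note \<rho>1 = assms(2) and \<rho>2 = assms(3)
  define S where "S = admissible_tests M \<rho>1 K1 K2 \<alpha>"
  define v where "v = (INF X\<in>S. \<rho>2 (\<lambda>x. K2 x - X x))"
  \<comment> \<open>The positive slack makes each set nonempty even before the infimum is known to
    be attained.\<close>
  define A where "A n = {X \<in> S. \<rho>2 (\<lambda>x. K2 x - X x) \<le> v + 1 / real (Suc n)}" for n
  obtain C1 C2 where C12: "AE x in M. \<bar>K1 x\<bar> \<le> C1" "AE x in M. \<bar>K2 x\<bar> \<le> C2"
    using assms(4,5) by (auto simp: Linfty_def)
  define C where "C = max C1 C2"
  have K_bound: "AE x in M. \<bar>K1 x\<bar> \<le> C \<and> \<bar>K2 x\<bar> \<le> C"
    using C12 by eventually_elim (auto simp: C_def)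
  have bound: "AE x in M. \<bar>X x\<bar> \<le> C" "AE x in M. \<bar>K2 x - X x\<bar> \<le> 2 * C"
    if "AE x in M. K1 x \<le> X x" "AE x in M. X x \<le> K2 x" for X
  proof -
    show "AE x in M. \<bar>X x\<bar> \<le> C" using that K_bound by eventually_elim linarith
    show "AE x in M. \<bar>K2 x - X x\<bar> \<le> 2 * C" using that K_bound by eventually_elim linarith
  qed
  have S: "X \<in> Linfty M" "X \<in> borel_measurable M" "AE x in M. K1 x \<le> X x"
      "AE x in M. X x \<le> K2 x" "\<rho>1 X \<le> \<alpha>" "(\<lambda>x. K2 x - X x) \<in> Linfty M" if "X \<in> S" for X
    using that assms(5) unfolding S_def admissible_tests_def
    by (auto intro: Linfty_diff Linfty_measurable)
  \<comment> \<open>A real \<open>INF\<close> is a genuine infimum only over a nonempty set bounded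
    below: \<open>K1\<close> is admissible, and \<open>K2 x - X x\<close> is nonnegative almost
    everywhere, so \<open>\<rho>2\<close> of zero is a lower bound.\<close>
  have "K1 \<in> S"
    unfolding S_def admissible_tests_def using assms(4,7,8) by (auto elim: eventually_mono)
  then have "S \<noteq> {}" by auto
  have bddS: "bdd_below ((\<lambda>X. \<rho>2 (\<lambda>x. K2 x - X x)) ` S)"
  proof (rule bdd_belowI2)
    fix X assume X: "X \<in> S"
    show "\<rho>2 (\<lambda>x. 0) \<le> \<rho>2 (\<lambda>x. K2 x - X x)"
      by (rule convex_expectation_mono[OF \<rho>2 LinftyI[where C=0] S(6)[OF X]])
         (use S(4)[OF X] in auto)
  qed
  have AS: "X \<in> S" "\<rho>2 (\<lambda>x. K2 x - X x) \<le> v + 1 / real (Suc n)" if "X \<in> A n" for X n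
    using that by (auto simp: A_def)
  have dec: "decseq A"
  proof (rule decseq_SucI)
    fix n
    have "1 / real (Suc (Suc n)) \<le> 1 / real (Suc n)" by (simp add: field_simps)
    then show "A (Suc n) \<le> A n" unfolding A_def by force
  qed
  have ne: "A n \<noteq> {}" for n
  proof -
    have "(INF X\<in>S. \<rho>2 (\<lambda>x. K2 x - X x)) < v + 1 / real (Suc n)"
      by (simp add: v_def)
    then have "\<exists>X\<in>S. \<rho>2 (\<lambda>x. K2 x - X x) < v + 1 / real (Suc n)"
      using \<open>S \<noteq> {}\<close> bddS by (subst (asm) cINF_less_iff) auto
    then show ?thesis by (auto simp: A_def intro: less_imp_le)
  qed
  have mid: "(\<lambda>x. (X x + Y x) / 2) \<in> A n" if XY: "X \<in> A n" "Y \<in> A n" for n X Y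
  proof -
    note X = S[OF AS(1)[OF XY(1)]] and Y = S[OF AS(1)[OF XY(2)]]
    have K: "AE x in M. K1 x \<le> (X x + Y x) / 2"
      using X(3) Y(3) by eventually_elim (simp add: field_simps)
    have K': "AE x in M. (X x + Y x) / 2 \<le> K2 x"
      using X(4) Y(4) by eventually_elim (simp add: field_simps)
    have "(\<lambda>x. (X x + Y x) / 2) \<in> Linfty M"
      using X(2) Y(2) by (intro LinftyI[OF _ bound(1)[OF K K']]) auto
    moreover have "\<rho>1 (\<lambda>x. (X x + Y x) / 2) \<le> \<alpha>"
      using X Y by (intro convex_expectation_midpoint[OF \<rho>1])
    moreover have "\<rho>2 (\<lambda>x. ((K2 x - X x) + (K2 x - Y x)) / 2) \<le> v + 1 / real (Suc n)"
      using X(6) Y(6) XY AS(2) by (intro convex_expectation_midpoint[OF \<rho>2])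
    \<comment> \<open>The map from \<open>X\<close> to \<open>K2 - X\<close> is affine, so the
      midpoint of the shortfalls is the shortfall of the midpoint.\<close>
    moreover have "(\<lambda>x. ((K2 x - X x) + (K2 x - Y x)) / 2) = (\<lambda>x. K2 x - (X x + Y x) / 2)"
      by (simp add: field_simps)
    ultimately show ?thesis
      using K K' by (simp add: A_def S_def admissible_tests_def)
  qed
  obtain f where f: "\<And>n. f n \<in> A n" and conv: "AE x in M. convergent (\<lambda>n. f n x)"
  proof (rule nested_convex_AE_convergent[OF dec ne _ _ mid])
    show "X \<in> borel_measurable M" "AE x in M. \<bar>X x\<bar> \<le> C" if "X \<in> A 0" for X
      using S(2)[OF AS(1)[OF that]] bound(1)[OF S(3,4)[OF AS(1)[OF that]]] by auto
  qed (assumption | rule that)+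
  note fS = S[OF AS(1)[OF f]]
  \<comment> \<open>Where the sequence diverges, \<open>lim\<close> is an arbitrary value; this
    happens only on a null set, and \<open>g\<close> is measurable all the same.\<close>
  define g where "g x = lim (\<lambda>n. f n x)" for x
  have g_meas: "g \<in> borel_measurable M"
    unfolding g_def using fS(2) by (rule borel_measurable_lim_metric)
  have lim: "AE x in M. (\<lambda>n. f n x) \<longlonglongrightarrow> g x"
    using conv by eventually_elim (simp add: g_def convergent_LIMSEQ_iff)
  have all: "AE x in M. \<forall>n. K1 x \<le> f n x" "AE x in M. \<forall>n. f n x \<le> K2 x"
    using fS(3,4) by (simp_all add: AE_all_countable)
  have gK: "AE x in M. K1 x \<le> g x" "AE x in M. g x \<le> K2 x"
  proof -
    show "AE x in M. K1 x \<le> g x"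
      using lim all(1) by eventually_elim (auto intro: LIMSEQ_le_const)
    show "AE x in M. g x \<le> K2 x"
      using lim all(2) by eventually_elim (auto intro: LIMSEQ_le_const2)
  qed
  have g_Linfty: "g \<in> Linfty M"
    by (rule LinftyI[OF g_meas bound(1)[OF gK]])
  \<comment> \<open>The constraint passes to the limit with a constant bound; the objective below
    uses a bound decreasing to \<open>v\<close>.\<close>
  have "\<rho>1 g \<le> \<alpha>"
    by (rule continuous_from_below_Fatou[where X = f and c = "\<lambda>_. \<alpha>", OF \<rho>1 assms(10)
          fS(2) bound(1)[OF fS(3,4)] g_Linfty lim fS(5) tendsto_const])
  then have gS: "g \<in> S"
    using g_Linfty gK by (simp add: S_def admissible_tests_def)
  have lim2: "AE x in M. (\<lambda>n. K2 x - f n x) \<longlonglongrightarrow> K2 x - g x"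
    using lim by eventually_elim (intro tendsto_intros)
  have v_lim: "(\<lambda>n. v + 1 / real (Suc n)) \<longlonglongrightarrow> v"
    using tendsto_add[OF tendsto_const[of v] LIMSEQ_inverse_real_of_nat]
    by (simp add: inverse_eq_divide)
  have "\<rho>2 (\<lambda>x. K2 x - g x) \<le> v"
    by (rule continuous_from_below_Fatou[where X = "\<lambda>n x. K2 x - f n x", OF \<rho>2 assms(11)
          Linfty_measurable[OF fS(6)] bound(2)[OF fS(3,4)] S(6)[OF gS] lim2 AS(2)[OF f] v_lim])
  moreover have "v \<le> \<rho>2 (\<lambda>x. K2 x - g x)"
    unfolding v_def by (rule cINF_lower[OF bddS gS])
  ultimately have "\<rho>2 (\<lambda>x. K2 x - g x) = v"
    by (rule antisym)
  then show ?thesis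
    using gS unfolding v_def S_def by (rule bexI)
qed

end
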